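(* Let $\xi,\eta\in(0,1)$, $\rho>0$, $T>0$, $\lambda>0$, let $a:[0,1]\to\mathbb{R}$ be continuous almost everywhere with $a(x)\neq0$, and let $q:[0,T]\to\mathbb{R}$ be a given function. For positive integers $n,m$ and $N=(n+1)m$ set $$A_N=\begin{bmatrix} U_n\otimes I_m+I_n\otimes\frac{\alpha_n}{\beta_m}G_m & -\alpha_n\,\mathbf{q}\otimes I_m\\ \mathbf{e}_n^T\otimes I_m & \frac{\lambda}{\beta_m}G_m\end{bmatrix},\qquad P_N=\begin{bmatrix} U_n\otimes I_m+I_n\otimes\frac{\alpha_n}{\beta_m}G_m & \mathrm{O}_{nm\times m}\\ \mathbf{e}_n^T\otimes I_m & \frac{\lambda}{\beta_m}G_m\end{bmatrix}.$$ Then, as $n,m\to\infty$, $$\{P_N^{-1}A_N\}_N\sim_{\mathrm{GLT}}1\quad\text{and}\quad \{P_N^{-1}A_N\}_N\sim_{\sigma}1.$$ Moreover, $$\{P_N^{-1}A_N\}_N\sim_\lambda 1.$$ Here the sequence is regarded as a two-level matrix sequence with multi-index $(n+1,m)$.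
   Context: Discretization matrices. For positive integers $n,m$: $\Delta t=T/n$, $t_j=j\Delta t$, $\alpha_n=(T/n)^{\xi}\,\Gamma(2-\xi)$, $\beta_m=(m+1)^{-\eta}\,\Gamma(2-\eta)$. Let $\gamma_0=1$, $\gamma_l=(l+1)^{1-\xi}-2l^{1-\xi}+(l-1)^{1-\xi}$ for $l\ge1$, and $\delta_0=1$, $\delta_k=(k+1)^{1-\eta}-2k^{1-\eta}+(k-1)^{1-\eta}$ for $k\ge1$. $U_n$ is the $n\times n$ lower triangular Toeplitz matrix with $(i,j)$ entry $\gamma_{i-j}e^{-\rho(i-j)\Delta t}$ for $i\ge j$ and $0$ otherwise. $B_m$ is the $m\times m$ lower triangular Toeplitz matrix with $(i,j)$ entry $\delta_{i-j}$ for $i\ge j$ and $0$ otherwise. $D_m(a)=\mathrm{diag}_{i=1,\dots,m}\,a(i/m)$, and $G_m=D_m(a)B_m$. $I_m$ is the identity of size $m$, $\mathrm{O}_{nm\times m}$ is the $nm\times m$ zero matrix, $\mathbf{e}_n=(0,\dots,0,1)^T\in\mathbb{R}^n$, $\mathbf{q}=(q(t_1),\dots,q(t_n))^T\in\mathbb{R}^n$, and $\otimes$ is the Kronecker product. Distributions. For a matrix sequence $\{A_n\}_n$ with $A_n$ of size $d_n\times d_n$, $d_n\to\infty$, and a measurable $\psi:D\subset\mathbb{R}^t\to\mathbb{C}$ with $0<\mu_t(D)<\infty$ ($\mu_t$ Lebesgue measure): $\{A_n\}_n\sim_\sigma\psi$ means that for every continuous compactly supported $F:\mathbb{R}\to\mathbb{C}$,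 $\lim_{n\to\infty}\frac1{d_n}\sum_{i=1}^{d_n}F(\sigma_i(A_n))=\frac1{\mu_t(D)}\int_D F(|\psi(\mathbf{x})|)\,d\mathbf{x}$, where $\sigma_i(A_n)$ are the singular values; $\{A_n\}_n\sim_\lambda\psi$ means that for every continuous compactly supported $F:\mathbb{C}\to\mathbb{C}$, $\lim_{n\to\infty}\frac1{d_n}\sum_{i=1}^{d_n}F(\lambda_i(A_n))=\frac1{\mu_t(D)}\int_D F(\psi(\mathbf{x}))\,d\mathbf{x}$, where $\lambda_i(A_n)$ are the eigenvalues (with algebraic multiplicity). (The symbol $\lambda$ in $\sim_\lambda$ is unrelated to the parameter $\lambda>0$.) GLT sequences ($d$-level, $d\ge 1$). A $d$-level matrix sequence $\{A_{\mathbf n}\}$ is indexed by a sequence of multi-indices $\mathbf n=(n_1,\dots,n_d)\in\mathbb{N}^d$ with $\min_i n_i\to\infty$, and $A_{\mathbf n}$ has size $N(\mathbf n)=n_1\cdots n_d$; rows and columns are indexed by multi-indices $\mathbf i$ with $1\le i_s\le n_s$ in lexicographic order. For $f\in L^1([-\pi,\pi]^d)$ with Fourier coefficients $\hat f_{\mathbf k}=(2\pi)^{-d}\int f(\boldsymbol\theta)e^{-\mathrm{i}\,\mathbf k\cdot\boldsymbol\theta}d\boldsymbol\theta$, $T_{\mathbf n}(f)=[\hat f_{\mathbf i-\mathbf j}]_{\mathbf i,\mathbf j}$; for $b:[0,1]^d\to\mathbb{C}$, $D_{\mathbf n}(b)=\mathrm{diag}_{\mathbf i}\,b(i_1/n_1,\dots,i_d/n_d)$.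 A family $\{\{B_{\mathbf n,r}\}_{\mathbf n}\}_{r\in\mathbb{N}}$ is an approximating class of sequences (a.c.s.) for $\{A_{\mathbf n}\}$ if there are $c(r),\omega(r)\to0$ as $r\to\infty$ such that for each $r$ and all sufficiently large $\mathbf n$ one has $A_{\mathbf n}=B_{\mathbf n,r}+R_{\mathbf n,r}+N_{\mathbf n,r}$ with $\mathrm{rank}(R_{\mathbf n,r})\le c(r)N(\mathbf n)$ and $\|N_{\mathbf n,r}\|\le\omega(r)$ (spectral norm). For measurable $\kappa:[0,1]^d\times[-\pi,\pi]^d\to\mathbb{C}$, $\{A_{\mathbf n}\}\sim_{\mathrm{GLT}}\kappa$ means: for every $r$ there are finitely many continuous $b_{i,r}:[0,1]^d\to\mathbb{C}$ and trigonometric polynomials $f_{i,r}$ such that $\sum_i b_{i,r}(\mathbf x)f_{i,r}(\boldsymbol\theta)\to\kappa(\mathbf x,\boldsymbol\theta)$ in measure as $r\to\infty$ and $\{\sum_i D_{\mathbf n}(b_{i,r})T_{\mathbf n}(f_{i,r})\}_{\mathbf n}$, $r\in\mathbb{N}$, is an a.c.s. for $\{A_{\mathbf n}\}$. The constant $1$ as a symbol or distribution function denotes the constant function equal to $1$.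
   Formalization: The formal theorem assumes P_N is invertible for every member of the sequence; the stated hypotheses do not imply this (e.g. a=-1, ξ=η=1/2, T=1, n=m+1 gives a singular P_N, so P_N^{-1} is undefined). *)

theory Defs
  imports
    "HOL-Analysis.Analysis"
    "Jordan_Normal_Form.Schur_Decomposition"
    "Jordan_Normal_Form.Gauss_Jordan_Elimination"
    "Jordan_Normal_Form.DL_Rank"
begin

no_notation Finite_Cartesian_Product.vec_nth (infixl \<open>$\<close> 90)

section \<open>Singular value and eigenvalue distributions\<close>

definition eigvals :: "complex mat \<Rightarrow> complex multiset" where
  "eigvals A = proots (char_poly A)"

(* for square A; the eigenvalues of A^* A are real and nonnegative *)
definition singvals :: "complex mat \<Rightarrow> real multiset" where
  "singvals A = image_mset (\<lambda>z. sqrt (Re z)) (eigvals (mat_adjoint A * A))"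

definition compactly_supported :: "('a::topological_space \<Rightarrow> complex) \<Rightarrow> bool" where
  "compactly_supported F \<longleftrightarrow> compact (closure {x. F x \<noteq> 0})"

definition matrix_seq :: "(nat \<Rightarrow> complex mat) \<Rightarrow> bool" where
  "matrix_seq A \<longleftrightarrow> (\<forall>k. square_mat (A k)) \<and> filterlim (\<lambda>k. dim_row (A k)) at_top sequentially"

definition distribution_function :: "'a::euclidean_space set \<Rightarrow> ('a \<Rightarrow> complex) \<Rightarrow> bool" where
  "distribution_function D \<psi> \<longleftrightarrow>
     D \<in> lmeasurable \<and> 0 < measure lebesgue D \<and> \<psi> \<in> borel_measurable (lebesgue_on D)"

definition sv_distributed ::
  "(nat \<Rightarrow> complex mat) \<Rightarrow> 'a::euclidean_space set \<Rightarrow> ('a \<Rightarrow> complex) \<Rightarrow> bool" where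
  "sv_distributed A D \<psi> \<longleftrightarrow>
     matrix_seq A \<and> distribution_function D \<psi> \<and>
     (\<forall>F :: real \<Rightarrow> complex. continuous_on UNIV F \<and> compactly_supported F \<longrightarrow>
        (\<lambda>k. (1 / of_nat (dim_row (A k))) * (\<Sum>s\<in>#singvals (A k). F s))
          \<longlonglongrightarrow> (1 / of_real (measure lebesgue D)) * (LINT x:D|lebesgue. F (cmod (\<psi> x))))"

definition ev_distributed ::
  "(nat \<Rightarrow> complex mat) \<Rightarrow> 'a::euclidean_space set \<Rightarrow> ('a \<Rightarrow> complex) \<Rightarrow> bool" where
  "ev_distributed A D \<psi> \<longleftrightarrow>
     matrix_seq A \<and> distribution_function D \<psi> \<and>
     (\<forall>F :: complex \<Rightarrow> complex. continuous_on UNIV F \<and> compactly_supported F \<longrightarrow>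
        (\<lambda>k. (1 / of_nat (dim_row (A k))) * (\<Sum>z\<in>#eigvals (A k). F z))
          \<longlonglongrightarrow> (1 / of_real (measure lebesgue D)) * (LINT x:D|lebesgue. F (\<psi> x)))"


section \<open>Two-level GLT sequences\<close>

text \<open>
  The case \<open>d = 2\<close>. A multi-index is a pair \<open>(n1, n2)\<close>. Matrices carry 0-based indices, and the row
  \<open>i < n1 * n2\<close> stands for the multi-index \<open>(i div n2 + 1, i mod n2 + 1)\<close>, which is the
  lexicographic order on 1-based multi-indices.
\<close>

definition unit_square :: "(real \<times> real) set" where
  "unit_square = {0..1} \<times> {0..1}"

definition freq_square :: "(real \<times> real) set" where
  "freq_square = {-pi..pi} \<times> {-pi..pi}"

definition glt_domain :: "((real \<times> real) \<times> (real \<times> real)) set" where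
  "glt_domain = unit_square \<times> freq_square"

fun msize :: "nat \<times> nat \<Rightarrow> nat" where
  "msize (n1, n2) = n1 * n2"

fun midx :: "nat \<times> nat \<Rightarrow> nat \<Rightarrow> nat \<times> nat" where
  "midx (n1, n2) i = (i div n2 + 1, i mod n2 + 1)"

definition fourier_mode :: "int \<times> int \<Rightarrow> real \<times> real \<Rightarrow> complex" where
  "fourier_mode k \<theta> = cis (of_int (fst k) * fst \<theta> + of_int (snd k) * snd \<theta>)"

definition fourier_coeff :: "(real \<times> real \<Rightarrow> complex) \<Rightarrow> int \<times> int \<Rightarrow> complex" where
  "fourier_coeff f k =
     (1 / of_real ((2 * pi)\<^sup>2)) * (LINT \<theta>:freq_square|lebesgue. f \<theta> * fourier_mode (- k) \<theta>)"

definition trig_polynomial :: "(real \<times> real \<Rightarrow> complex) \<Rightarrow> bool" where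
  "trig_polynomial f \<longleftrightarrow>
     (\<exists>K c. finite K \<and> f = (\<lambda>\<theta>. \<Sum>k\<in>K. c k * fourier_mode k \<theta>))"

definition toeplitz2 :: "nat \<times> nat \<Rightarrow> (real \<times> real \<Rightarrow> complex) \<Rightarrow> complex mat" where
  "toeplitz2 \<nu> f = mat (msize \<nu>) (msize \<nu>) (\<lambda>(i, j).
     fourier_coeff f (int (fst (midx \<nu> i)) - int (fst (midx \<nu> j)),
                      int (snd (midx \<nu> i)) - int (snd (midx \<nu> j))))"

definition diag_sampling2 :: "nat \<times> nat \<Rightarrow> (real \<times> real \<Rightarrow> complex) \<Rightarrow> complex mat" where
  "diag_sampling2 \<nu> b = mat_diag (msize \<nu>) (\<lambda>i.
     b (real (fst (midx \<nu> i)) / real (fst \<nu>), real (snd (midx \<nu> i)) / real (snd \<nu>)))"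

definition vec_norm2 :: "complex vec \<Rightarrow> real" where
  "vec_norm2 v = L2_set (\<lambda>i. cmod (v $ i)) {..<dim_vec v}"

definition spectral_norm :: "complex mat \<Rightarrow> real" where
  "spectral_norm A = (SUP v\<in>{v \<in> carrier_vec (dim_col A). vec_norm2 v = 1}. vec_norm2 (A *\<^sub>v v))"

definition acs ::
  "(nat \<Rightarrow> nat \<times> nat) \<Rightarrow> (nat \<Rightarrow> nat \<Rightarrow> complex mat) \<Rightarrow> (nat \<Rightarrow> complex mat) \<Rightarrow> bool" where
  "acs \<nu> B A \<longleftrightarrow>
     (\<exists>c \<omega> :: nat \<Rightarrow> real. c \<longlonglongrightarrow> 0 \<and> \<omega> \<longlonglongrightarrow> 0 \<and>
        (\<forall>r. \<forall>\<^sub>F k in sequentially.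
           \<exists>R \<in> carrier_mat (msize (\<nu> k)) (msize (\<nu> k)).
           \<exists>E \<in> carrier_mat (msize (\<nu> k)) (msize (\<nu> k)).
             A k = B r k + R + E \<and>
             real (vec_space.rank (msize (\<nu> k)) R) \<le> c r * real (msize (\<nu> k)) \<and>
             spectral_norm E \<le> \<omega> r))"

definition converges_in_measure ::
  "'a::euclidean_space set \<Rightarrow> (nat \<Rightarrow> 'a \<Rightarrow> complex) \<Rightarrow> ('a \<Rightarrow> complex) \<Rightarrow> bool" where
  "converges_in_measure D g \<kappa> \<longleftrightarrow>
     (\<forall>\<epsilon>>0. (\<lambda>r. measure lebesgue {x \<in> D. cmod (g r x - \<kappa> x) > \<epsilon>}) \<longlonglongrightarrow> 0)"

(* The sum of the D_n(b i) T_n(f i) for i < p, taken entrywise since matrices of varying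
   size do not form a monoid type. *)
definition glt_sum ::
  "nat \<times> nat \<Rightarrow> nat \<Rightarrow> (nat \<Rightarrow> real \<times> real \<Rightarrow> complex) \<Rightarrow> (nat \<Rightarrow> real \<times> real \<Rightarrow> complex) \<Rightarrow> complex mat"
  where
  "glt_sum \<nu> p b f = mat (msize \<nu>) (msize \<nu>) (\<lambda>ij.
     \<Sum>i<p. (diag_sampling2 \<nu> (b i) * toeplitz2 \<nu> (f i)) $$ ij)"

definition two_level_GLT ::
  "(nat \<Rightarrow> nat \<times> nat) \<Rightarrow> (nat \<Rightarrow> complex mat) \<Rightarrow> ((real \<times> real) \<times> (real \<times> real) \<Rightarrow> complex) \<Rightarrow> bool"
  where
  "two_level_GLT \<nu> A \<kappa> \<longleftrightarrow>
     filterlim (\<lambda>k. min (fst (\<nu> k)) (snd (\<nu> k))) at_top sequentially \<and>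
     (\<forall>k. A k \<in> carrier_mat (msize (\<nu> k)) (msize (\<nu> k))) \<and>
     \<kappa> \<in> borel_measurable (lebesgue_on glt_domain) \<and>
     (\<exists>(p :: nat \<Rightarrow> nat) b f.
        (\<forall>r. \<forall>i<p r. continuous_on unit_square (b r i) \<and> trig_polynomial (f r i)) \<and>
        converges_in_measure glt_domain (\<lambda>r (x, \<theta>). \<Sum>i<p r. b r i x * f r i \<theta>) \<kappa> \<and>
        acs \<nu> (\<lambda>r k. glt_sum (\<nu> k) (p r) (b r) (f r)) A)"


section \<open>The discretization matrices\<close>

definition kronecker :: "'a::times mat \<Rightarrow> 'a mat \<Rightarrow> 'a mat" where
  "kronecker A B = mat (dim_row A * dim_row B) (dim_col A * dim_col B) (\<lambda>(i, j).
     A $$ (i div dim_row B, j div dim_col B) * B $$ (i mod dim_row B, j mod dim_col B))"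

definition alpha :: "real \<Rightarrow> real \<Rightarrow> nat \<Rightarrow> real" where
  "alpha \<xi> T n = (T / real n) powr \<xi> * Gamma (2 - \<xi>)"

definition beta :: "real \<Rightarrow> nat \<Rightarrow> real" where
  "beta \<eta> m = (real m + 1) powr (- \<eta>) * Gamma (2 - \<eta>)"

(* gamma_l is frac_weight \<xi> l and delta_k is frac_weight \<eta> k; note 0 powr s = 0 *)
definition frac_weight :: "real \<Rightarrow> nat \<Rightarrow> real" where
  "frac_weight s l = (if l = 0 then 1
     else (real l + 1) powr (1 - s) - 2 * real l powr (1 - s) + (real l - 1) powr (1 - s))"

definition U_mat :: "real \<Rightarrow> real \<Rightarrow> real \<Rightarrow> nat \<Rightarrow> real mat" where
  "U_mat \<xi> \<rho> T n = mat n n (\<lambda>(i, j).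
     if j \<le> i then frac_weight \<xi> (i - j) * exp (- \<rho> * real (i - j) * (T / real n)) else 0)"

definition B_mat :: "real \<Rightarrow> nat \<Rightarrow> real mat" where
  "B_mat \<eta> m = mat m m (\<lambda>(i, j). if j \<le> i then frac_weight \<eta> (i - j) else 0)"

definition G_mat :: "real \<Rightarrow> (real \<Rightarrow> real) \<Rightarrow> nat \<Rightarrow> real mat" where
  "G_mat \<eta> a m = mat_diag m (\<lambda>i. a (real (i + 1) / real m)) * B_mat \<eta> m"

definition q_vec :: "real \<Rightarrow> (real \<Rightarrow> real) \<Rightarrow> nat \<Rightarrow> real vec" where
  "q_vec T q n = vec n (\<lambda>j. q (real (j + 1) * (T / real n)))"

definition block11 :: "real \<Rightarrow> real \<Rightarrow> real \<Rightarrow> real \<Rightarrow> (real \<Rightarrow> real) \<Rightarrow> nat \<Rightarrow> nat \<Rightarrow> real mat" where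
  "block11 \<xi> \<eta> \<rho> T a n m =
     kronecker (U_mat \<xi> \<rho> T n) (1\<^sub>m m)
     + kronecker (1\<^sub>m n) ((alpha \<xi> T n / beta \<eta> m) \<cdot>\<^sub>m G_mat \<eta> a m)"

definition A_mat ::
  "real \<Rightarrow> real \<Rightarrow> real \<Rightarrow> real \<Rightarrow> real \<Rightarrow> (real \<Rightarrow> real) \<Rightarrow> (real \<Rightarrow> real) \<Rightarrow> nat \<Rightarrow> nat \<Rightarrow> real mat" where
  "A_mat \<xi> \<eta> \<rho> T l a q n m = four_block_mat
     (block11 \<xi> \<eta> \<rho> T a n m)
     ((- alpha \<xi> T n) \<cdot>\<^sub>m kronecker (mat_of_cols n [q_vec T q n]) (1\<^sub>m m))
     (kronecker (mat_of_row (unit_vec n (n - 1))) (1\<^sub>m m))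
     ((l / beta \<eta> m) \<cdot>\<^sub>m G_mat \<eta> a m)"

definition P_mat ::
  "real \<Rightarrow> real \<Rightarrow> real \<Rightarrow> real \<Rightarrow> real \<Rightarrow> (real \<Rightarrow> real) \<Rightarrow> nat \<Rightarrow> nat \<Rightarrow> real mat" where
  "P_mat \<xi> \<eta> \<rho> T l a n m = four_block_mat
     (block11 \<xi> \<eta> \<rho> T a n m)
     (0\<^sub>m (n * m) m)
     (kronecker (mat_of_row (unit_vec n (n - 1))) (1\<^sub>m m))
     ((l / beta \<eta> m) \<cdot>\<^sub>m G_mat \<eta> a m)"

(* mat_inverse yields Some inverse exactly when P_mat is invertible, so this is meaningful only
   then. P_mat is block lower triangular with lower triangular diagonal blocks; for a without zeros
   it is invertible iff 1 + (alpha_n / beta_m) a(i/m) is nonzero for i = 1..m. This always holds for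
   a > 0, but can fail for particular (n, m) where a takes negative values. *)
definition preconditioned ::
  "real \<Rightarrow> real \<Rightarrow> real \<Rightarrow> real \<Rightarrow> real \<Rightarrow> (real \<Rightarrow> real) \<Rightarrow> (real \<Rightarrow> real) \<Rightarrow> nat \<Rightarrow> nat \<Rightarrow> complex mat" where
  "preconditioned \<xi> \<eta> \<rho> T l a q n m = map_mat complex_of_real
     (the (mat_inverse (P_mat \<xi> \<eta> \<rho> T l a n m)) * A_mat \<xi> \<eta> \<rho> T l a q n m)"

end

theory Submission
  imports Defs "HOL-Computational_Algebra.Fundamental_Theorem_Algebra"
begin

text \<open>
  The matrices \<open>A\<close> and \<open>P\<close> agree in their first \<open>n m\<close> columns, so \<open>X = P\<^sup>-\<^sup>1 A\<close> has the same first
  \<open>n m\<close> columns as the identity. Hence \<open>X - 1\<close> has rank at most \<open>m\<close>, which is negligible against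
  the size \<open>(n + 1) m\<close>: the constant sequence of identities is an approximating class of sequences
  for \<open>X\<close>. Moreover \<open>X\<close> and \<open>X\<^sup>* X\<close> both have \<open>1\<close> as upper left \<open>n m \<times> n m\<close> block, which forces the
  eigenvalue \<open>1\<close> to have algebraic multiplicity at least \<open>n m - m\<close>, so the at most \<open>2 m\<close> remaining
  eigenvalues do not contribute to the averages in the limit.
\<close>

section \<open>Multiplicity of an eigenvalue forced by an identity block\<close>

lemma order_ge_if_power_mult_eq:
  fixes d e :: "'a::idom poly"
  assumes eq: "d * [:- c, 1:] ^ s = [:- c, 1:] ^ p * e" and "d \<noteq> 0"
  shows "p \<le> Polynomial.order c d + s"
proof -
  have "d * [:- c, 1:] ^ s \<noteq> 0" using \<open>d \<noteq> 0\<close> by simp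
  moreover have "[:- c, 1:] ^ p dvd d * [:- c, 1:] ^ s" unfolding eq by simp
  ultimately have "p \<le> Polynomial.order c (d * [:- c, 1:] ^ s)"
    using order_max by blast
  also have "\<dots> = Polynomial.order c d + s"
    using \<open>d * [:- c, 1:] ^ s \<noteq> 0\<close> by (simp add: order_mult order_power_n_n)
  finally show ?thesis .
qed

text \<open>With \<open>?t\<close> = x - 1, the characteristic matrix has \<open>?t\<close> times
  the identity as upper left block. Column operations of determinant \<open>?t ^ s\<close> make it
  block triangular, so \<open>?t ^ p\<close> divides the characteristic polynomial times
  \<open>?t ^ s\<close>. A loss of \<open>s\<close> can occur: the 2 by 2 matrix with rows (1, 1)
  and (1, 0) does not have the eigenvalue 1.\<close>

lemma order_char_poly_identity_block:
  fixes H :: "'a::field mat"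
  assumes H: "H \<in> carrier_mat (p + s) (p + s)"
    and one: "\<And>i j. i < p \<Longrightarrow> j < p \<Longrightarrow> H $$ (i, j) = (if i = j then 1 else 0)"
  shows "p \<le> Polynomial.order 1 (char_poly H) + s"
proof -
  let ?t = "[:- 1, 1:] :: 'a poly"
  define Y where "Y = mat p s (\<lambda>(i, j). [:- H $$ (i, j + p):])"
  define Z where "Z = mat s p (\<lambda>(i, j). [:- H $$ (i + p, j):])"
  define Q where "Q = mat s s (\<lambda>(i, j). char_poly_matrix H $$ (i + p, j + p))"
  have carr [simp]: "Y \<in> carrier_mat p s" "Z \<in> carrier_mat s p" "Q \<in> carrier_mat s s"
    by (auto simp: Y_def Z_def Q_def)
  have [simp]: "dim_row Y = p" "dim_col Y = s"
    by (auto simp: Y_def)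
  have block: "char_poly_matrix H = four_block_mat (?t \<cdot>\<^sub>m 1\<^sub>m p) Y Z Q"
    by (rule eq_matI) (use H one in \<open>auto simp: char_poly_matrix_def Y_def Z_def Q_def one_pCons\<close>)
  have "?t \<cdot>\<^sub>m 1\<^sub>m p * (- Y) = ?t \<cdot>\<^sub>m (- Y)"
    by (subst mult_smult_assoc_mat[of _ p p _ s]) (auto simp: left_mult_one_mat[of _ p s])
  moreover have "Y * (?t \<cdot>\<^sub>m 1\<^sub>m s) = ?t \<cdot>\<^sub>m Y"
    by (subst mult_smult_distrib[of _ p s _ s]) (auto simp: right_mult_one_mat[of _ p s])
  ultimately have zero: "?t \<cdot>\<^sub>m 1\<^sub>m p * (- Y) + Y * (?t \<cdot>\<^sub>m 1\<^sub>m s) = 0\<^sub>m p s"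
    by (auto intro!: eq_matI)
  txt \<open>Right multiplication by \<open>[1, -Y; 0, t]\<close>, of determinant \<open>t ^ s\<close>, clears the upper right block.\<close>
  have "four_block_mat (?t \<cdot>\<^sub>m 1\<^sub>m p) Y Z Q *
      four_block_mat (1\<^sub>m p) (- Y) (0\<^sub>m s p) (?t \<cdot>\<^sub>m 1\<^sub>m s) =
      four_block_mat (?t \<cdot>\<^sub>m 1\<^sub>m p * 1\<^sub>m p + Y * 0\<^sub>m s p)
        (?t \<cdot>\<^sub>m 1\<^sub>m p * (- Y) + Y * (?t \<cdot>\<^sub>m 1\<^sub>m s))
        (Z * 1\<^sub>m p + Q * 0\<^sub>m s p) (Z * (- Y) + Q * (?t \<cdot>\<^sub>m 1\<^sub>m s))"
    by (rule mult_four_block_mat[of _ p p _ s _ s _ _ p _ s]) auto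
  also have "\<dots> = four_block_mat (?t \<cdot>\<^sub>m 1\<^sub>m p) (0\<^sub>m p s) Z (Z * (- Y) + Q * (?t \<cdot>\<^sub>m 1\<^sub>m s))"
    unfolding zero
    by (simp add: right_mult_one_mat[of _ p p] right_mult_one_mat[of Z s p]
        right_mult_zero_mat[of _ p s] right_mult_zero_mat[of _ s s]
        right_add_zero_mat[of _ p p] right_add_zero_mat[of Z s p])
  finally have "four_block_mat (?t \<cdot>\<^sub>m 1\<^sub>m p) Y Z Q *
      four_block_mat (1\<^sub>m p) (- Y) (0\<^sub>m s p) (?t \<cdot>\<^sub>m 1\<^sub>m s) =
      four_block_mat (?t \<cdot>\<^sub>m 1\<^sub>m p) (0\<^sub>m p s) Z (Z * (- Y) + Q * (?t \<cdot>\<^sub>m 1\<^sub>m s))" .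
  then have "det (four_block_mat (?t \<cdot>\<^sub>m 1\<^sub>m p) Y Z Q) *
      det (four_block_mat (1\<^sub>m p) (- Y) (0\<^sub>m s p) (?t \<cdot>\<^sub>m 1\<^sub>m s)) =
      det (four_block_mat (?t \<cdot>\<^sub>m 1\<^sub>m p) (0\<^sub>m p s) Z (Z * (- Y) + Q * (?t \<cdot>\<^sub>m 1\<^sub>m s)))"
    by (subst det_mult[symmetric, of _ "p + s"]) auto
  also have "\<dots> = ?t ^ p * det (Z * (- Y) + Q * (?t \<cdot>\<^sub>m 1\<^sub>m s))"
    by (subst det_four_block_mat_upper_right_zero[of _ p _ s])
      (auto simp: det_smult intro!: add_carrier_mat mult_carrier_mat[of _ _ s])
  also have "det (four_block_mat (1\<^sub>m p) (- Y) (0\<^sub>m s p) (?t \<cdot>\<^sub>m 1\<^sub>m s)) = ?t ^ s"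
    by (subst det_four_block_mat_lower_left_zero[of _ p _ s]) (auto simp: det_smult)
  finally have "char_poly H * ?t ^ s = ?t ^ p * det (Z * (- Y) + Q * (?t \<cdot>\<^sub>m 1\<^sub>m s))"
    by (simp add: char_poly_def block)
  moreover have "char_poly H \<noteq> 0"
    using degree_monic_char_poly[OF H] by auto
  ultimately show ?thesis by (rule order_ge_if_power_mult_eq)
qed

section \<open>Eigenvalues and singular values of matrices with leading unit columns\<close>

lemma size_eigvals:
  assumes "A \<in> carrier_mat d d"
  shows "size (eigvals A) = d"
  using degree_monic_char_poly[OF assms] by (simp add: eigvals_def size_proots_complex)

lemma count_eigvals:
  assumes "A \<in> carrier_mat d d"
  shows "count (eigvals A) z = Polynomial.order z (char_poly A)"
proof -
  have "char_poly A \<noteq> 0"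
    using degree_monic_char_poly[OF assms] by auto
  then show ?thesis by (simp add: eigvals_def)
qed

text \<open>Other preimages of \<open>f x\<close> can only add to its count. This transfers
  multiplicities from the eigenvalues of X^* X to their square roots.\<close>

lemma count_image_mset_ge: "count M x \<le> count (image_mset f M) (f x)"
proof -
  have "replicate_mset (count M x) x \<subseteq># M"
    by (metis count_le_replicate_mset_subset_eq order_refl)
  then have "image_mset f (replicate_mset (count M x) x) \<subseteq># image_mset f M"
    by (rule image_mset_subseteq_mono)
  then show ?thesis
    by (simp add: count_le_replicate_mset_subset_eq)
qed

text \<open>Entry (i, j) is the inner product of columns i and j of \<open>X\<close>, which are
  distinct or equal standard unit vectors when both indices are below \<open>p\<close>. Rows from
  \<open>p\<close> on may have nonzero entries in these columns, so X^* X inherits only the identity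
  block, not the unit columns.\<close>

lemma mat_adjoint_mult_unit_cols:
  fixes X :: "complex mat"
  assumes X: "X \<in> carrier_mat d d"
    and cols: "\<And>i j. i < d \<Longrightarrow> j < p \<Longrightarrow> X $$ (i, j) = (if i = j then 1 else 0)"
    and "p \<le> d" "i < p" "j < p"
  shows "(mat_adjoint X * X) $$ (i, j) = (if i = j then 1 else 0)"
proof -
  have "(mat_adjoint X * X) $$ (i, j) = scalar_prod (row (mat_adjoint X) i) (col X j)"
    using assms by (subst index_mult_mat) (auto simp: mat_adjoint_def)
  also have "\<dots> = scalar_prod (conjugate (col X i)) (col X j)"
    using assms by (subst mat_adjoint_def, subst mat_of_rows_row) auto
  also have "\<dots> = (\<Sum>k<d. cnj (X $$ (k, i)) * X $$ (k, j))"
    using assms by (simp add: scalar_prod_def atLeast0LessThan)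
  also have "\<dots> = (\<Sum>k<d. if k = i then (if i = j then 1 else 0) else 0)"
    using assms by (intro sum.cong) (auto simp: cols)
  also have "\<dots> = (if i = j then 1 else 0)"
    using assms by simp
  finally show ?thesis .
qed

lemma count_eigvals_unit_cols:
  assumes X: "X \<in> carrier_mat (p + s) (p + s)"
    and cols: "\<And>i j. i < p + s \<Longrightarrow> j < p \<Longrightarrow> X $$ (i, j) = (if i = j then 1 else 0)"
  shows "p \<le> count (eigvals X) 1 + s"
  using order_char_poly_identity_block[OF X] cols by (simp add: count_eigvals[OF X])

lemma mat_adjoint_carrier:
  assumes "X \<in> carrier_mat d e"
  shows "mat_adjoint X \<in> carrier_mat e d"
  using assms by (auto simp: mat_adjoint_def)

lemma size_singvals:
  assumes "X \<in> carrier_mat d d"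
  shows "size (singvals X) = d"
  using size_eigvals[of "mat_adjoint X * X" d] mat_adjoint_carrier[OF assms] assms
  by (simp add: singvals_def)

lemma count_singvals_unit_cols:
  assumes X: "X \<in> carrier_mat (p + s) (p + s)"
    and cols: "\<And>i j. i < p + s \<Longrightarrow> j < p \<Longrightarrow> X $$ (i, j) = (if i = j then 1 else 0)"
  shows "p \<le> count (singvals X) 1 + s"
proof -
  have H: "mat_adjoint X * X \<in> carrier_mat (p + s) (p + s)"
    using X mat_adjoint_carrier[OF X] by simp
  have "p \<le> Polynomial.order 1 (char_poly (mat_adjoint X * X)) + s"
    using mat_adjoint_mult_unit_cols[OF X, of p] cols
    by (intro order_char_poly_identity_block[OF H]) auto
  \<comment> \<open>The eigenvalue 1 of X^* X becomes the singular value sqrt 1 = 1.\<close>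
  also have "Polynomial.order 1 (char_poly (mat_adjoint X * X)) \<le> count (singvals X) 1"
    using count_image_mset_ge[of "eigvals (mat_adjoint X * X)" 1 "\<lambda>z. sqrt (Re z)"]
    by (simp add: singvals_def count_eigvals[OF H])
  finally show ?thesis by simp
qed

section \<open>Averages over multisets clustered at one value\<close>

lemma norm_sum_mset_le:
  fixes F :: "'a \<Rightarrow> 'b::real_normed_vector"
  assumes "\<And>x. norm (F x) \<le> C"
  shows "norm (\<Sum>x\<in>#M. F x) \<le> real (size M) * C"
proof (induction M)
  case (add x M)
  then show ?case
    using norm_triangle_ineq[of "F x" "\<Sum>x\<in>#M. F x"] assms[of x] by (simp add: algebra_simps)
qed simp

text \<open>All but at most \<open>s k\<close> of the \<open>d k\<close> values equal
  \<open>c\<close>. The exceptions move the average by at most 2 C s / d, which tends to 0.\<close>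

lemma average_tendsto_cluster_value:
  fixes F :: "'a \<Rightarrow> complex" and M :: "nat \<Rightarrow> 'a multiset" and d s :: "nat \<Rightarrow> nat"
  assumes bound: "\<And>x. cmod (F x) \<le> C"
    and size: "\<And>k. size (M k) \<le> d k"
    and count: "\<And>k. d k \<le> count (M k) c + s k"
    and pos: "\<And>k. 0 < d k"
    and lim: "(\<lambda>k. real (s k) / real (d k)) \<longlonglongrightarrow> 0"
  shows "(\<lambda>k. (1 / of_nat (d k)) * (\<Sum>x\<in>#M k. F x)) \<longlonglongrightarrow> F c"
proof -
  have "0 \<le> C" using bound[of c] norm_ge_zero order_trans by blast
  have est: "cmod ((1 / of_nat (d k)) * (\<Sum>x\<in>#M k. F x) - F c) \<le> 2 * C * (real (s k) / real (d k))" for k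
  proof -
    let ?R = "filter_mset (\<lambda>x. x \<noteq> c) (M k)" and ?n = "count (M k) c"
    have split: "M k = replicate_mset ?n c + ?R"
      by (rule multiset_eqI) auto
    have sz: "size (M k) = ?n + size ?R"
      by (subst split) simp
    then have n: "?n \<le> d k" "size ?R \<le> s k" "d k - ?n \<le> s k"
      using size[of k] count[of k] by linarith+
    have "(\<Sum>x\<in>#M k. F x) = of_nat ?n * F c + (\<Sum>x\<in>#?R. F x)"
      by (subst split) simp
    \<comment> \<open>The \<open>?n\<close> copies of \<open>c\<close> cancel. What remains is the
      sum over the other elements and the deficit \<open>d k - ?n\<close>, each made of at most
      \<open>s k\<close> terms bounded by \<open>C\<close>.\<close>
    then have "(\<Sum>x\<in>#M k. F x) - of_nat (d k) * F c = (\<Sum>x\<in>#?R. F x) - of_nat (d k - ?n) * F c"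
      using n(1) by (simp add: of_nat_diff algebra_simps)
    also have "cmod \<dots> \<le> real (size ?R) * C + real (d k - ?n) * C"
      using norm_sum_mset_le[of F C ?R] bound
      by (intro order_trans[OF norm_triangle_ineq4] add_mono) (auto simp: norm_mult intro: mult_left_mono)
    also have "\<dots> \<le> real (s k) * C + real (s k) * C"
      using n \<open>0 \<le> C\<close> by (intro add_mono mult_right_mono) auto
    finally have "cmod ((\<Sum>x\<in>#M k. F x) - of_nat (d k) * F c) \<le> 2 * C * real (s k)"
      by (simp add: algebra_simps)
    moreover have "(1 / of_nat (d k)) * (\<Sum>x\<in>#M k. F x) - F c =
        ((\<Sum>x\<in>#M k. F x) - of_nat (d k) * F c) / of_nat (d k)"
      using pos[of k] by (simp add: field_simps)
    ultimately show ?thesis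
      using pos[of k] by (simp add: norm_divide divide_right_mono)
  qed
  have "(\<lambda>k. (1 / of_nat (d k)) * (\<Sum>x\<in>#M k. F x) - F c) \<longlonglongrightarrow> 0"
    by (rule Lim_null_comparison[where g = "\<lambda>k. 2 * C * (real (s k) / real (d k))"])
      (use est lim tendsto_mult_left[OF lim, of "2 * C"] in \<open>auto simp del: times_divide_eq_right\<close>)
  then show ?thesis by (simp add: LIM_zero_iff)
qed

lemma compactly_supported_bounded:
  fixes F :: "'a::topological_space \<Rightarrow> complex"
  assumes "continuous_on UNIV F" "compactly_supported F"
  obtains C where "\<And>x. cmod (F x) \<le> C"
proof -
  let ?K = "closure {x. F x \<noteq> 0}"
  have "compact (F ` ?K)"
    using assms by (intro compact_continuous_image)
      (auto simp: compactly_supported_def intro: continuous_on_subset)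
  then obtain C where C: "\<And>x. x \<in> ?K \<Longrightarrow> cmod (F x) \<le> C"
    using compact_imp_bounded bounded_iff by (metis imageI)
  \<comment> \<open>Outside the support \<open>F\<close> vanishes. The maximum with 0 guards against
    a negative \<open>C\<close>, possible when the support is empty.\<close>
  have "cmod (F x) \<le> max C 0" for x
    using C[of x] closure_subset[of "{x. F x \<noteq> 0}"] by (cases "F x = 0") (auto simp: le_max_iff_disj)
  then show ?thesis using that by blast
qed

section \<open>Constant distribution functions on the GLT domain\<close>

lemma glt_domain_eq_cbox: "glt_domain = cbox ((0, 0), (- pi, - pi)) ((1, 1), (pi, pi))"
  by (simp add: glt_domain_def unit_square_def freq_square_def cbox_Pair_eq)

lemma distribution_function_glt_domain: "distribution_function glt_domain (\<lambda>_. c)"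
  by (simp add: distribution_function_def glt_domain_eq_cbox content_Pair)

lemma average_const_glt_domain:
  "(1 / of_real (measure lebesgue glt_domain)) * (LINT x:glt_domain|lebesgue. c) = (c :: complex)"
proof -
  have D: "glt_domain \<in> lmeasurable" "0 < measure lebesgue glt_domain"
    using distribution_function_glt_domain[of 0] by (auto simp: distribution_function_def)
  then have "(LINT x:glt_domain|lebesgue. c) = measure lebesgue glt_domain *\<^sub>R c"
    unfolding set_lebesgue_integral_def
    by (intro has_bochner_integral_integral_eq has_bochner_integral_indicator)
      (auto simp: fmeasurable_def)
  then show ?thesis using D(2) by (simp add: scaleR_conv_of_real)
qed

section \<open>Rank and norm of the correction terms\<close>

text \<open>The rank is the size of a maximal independent set of columns. Such a set omits the zero
  vector, so all its members come from the last \<open>s\<close> columns.\<close>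

lemma rank_le_nonzero_cols:
  fixes R :: "'a::field mat"
  assumes R: "R \<in> carrier_mat d (p + s)"
    and zero: "\<And>i j. i < d \<Longrightarrow> j < p \<Longrightarrow> R $$ (i, j) = 0"
  shows "vec_space.rank d R \<le> s"
proof -
  interpret vec_space "TYPE('a)" d .
  obtain S where S: "maximal S (\<lambda>T. T \<subseteq> set (cols R) \<and> lin_indpt T)"
    using maximal_exists_superset[of "set (cols R)" "\<lambda>T. T \<subseteq> set (cols R) \<and> lin_indpt T" "{}"]
    by (auto simp: lin_dep_def)
  then have sub: "S \<subseteq> set (cols R)" and indpt: "lin_indpt S"
    by (auto simp: maximal_def)
  \<comment> \<open>Independence excludes the zero vector only over nontrivial scalars.\<close>
  have "UNIV \<noteq> {0 :: 'a}"
    by (metis UNIV_I singletonD zero_neq_one)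
  then have "0\<^sub>v d \<notin> S"
    using zero_nin_lin_indpt[of S] sub cols_dim[of R] R indpt by auto
  have "S \<subseteq> col R ` {p..<p + s}"
  proof
    fix v assume "v \<in> S"
    with sub obtain j where j: "j < p + s" "v = col R j"
      using R by (auto simp: cols_def)
    have "\<not> j < p"
    proof
      assume "j < p"
      then have "v = 0\<^sub>v d"
        using j R zero by (intro eq_vecI) auto
      with \<open>v \<in> S\<close> \<open>0\<^sub>v d \<notin> S\<close> show False by simp
    qed
    with j show "v \<in> col R ` {p..<p + s}" by auto
  qed
  then have "card S \<le> s"
    using surj_card_le[of "{p..<p + s}" S "col R"] by simp
  then show ?thesis using rank_card_indpt[OF R S] by simp
qed

text \<open>For \<open>d = 0\<close> there are no unit vectors and the supremum would range over the
  empty set of reals. For positive \<open>d\<close> the vector \<open>unit_vec d 0\<close> makes the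
  range exactly {0}.\<close>

lemma spectral_norm_zero:
  assumes "0 < d"
  shows "spectral_norm (0\<^sub>m d d) = 0"
proof -
  have "(\<Sum>i<d. (cmod (unit_vec d 0 $ i))\<^sup>2) = (\<Sum>i<d. if i = 0 then 1 else 0)"
    by (rule sum.cong) auto
  then have "vec_norm2 (unit_vec d 0) = 1"
    using assms by (simp add: vec_norm2_def L2_set_def)
  then have "unit_vec d 0 \<in> {v \<in> carrier_vec d. vec_norm2 v = 1}" by simp
  then have ne: "{v \<in> carrier_vec d. vec_norm2 v = 1} \<noteq> {}" by blast
  have "(\<lambda>v. vec_norm2 (0\<^sub>m d d *\<^sub>v v)) ` {v \<in> carrier_vec d. vec_norm2 v = 1} = {0}"
  proof -
    have "vec_norm2 (0\<^sub>m d d *\<^sub>v v) = 0" if "v \<in> carrier_vec d" for v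
      using that by (simp add: vec_norm2_def L2_set_def)
    with ne show ?thesis by auto
  qed
  then show ?thesis by (simp add: spectral_norm_def)
qed

section \<open>The constant symbol 1 and its GLT approximants\<close>

lemma integral_cis_period:
  fixes k :: int
  shows "integral {- pi..pi} (\<lambda>x. cis (of_int k * x)) = (if k = 0 then of_real (2 * pi) else 0)"
proof (cases "k = 0")
  case False
  have "((\<lambda>x. cis (of_int k * x)) has_integral
      cis (of_int k * pi) / (\<i> * of_int k) - cis (of_int k * (- pi)) / (\<i> * of_int k)) {- pi..pi}"
    using False
    by (intro fundamental_theorem_of_calculus)
      (auto simp: cis_conv_exp has_real_derivative_iff_has_vector_derivative[symmetric]
        intro!: derivative_eq_intros has_vector_derivative_real_field simp: mult.commute[of "exp _" \<i>])
  \<comment> \<open>The two values have equal cosine parts and opposite sine parts, and sin(k pi) =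
    0 for an integer k.\<close>
  moreover have "cis (of_int k * pi) = cis (of_int k * (- pi))"
    by (simp add: complex_eq_iff sin_times_pi_eq_0)
  ultimately show ?thesis using False by (simp add: integral_unique)
qed (simp add: scaleR_conv_of_real)

lemma fourier_coeff_one: "fourier_coeff (\<lambda>_. 1) k = (if k = 0 then 1 else 0)"
proof -
  let ?f = "fourier_mode (- k)"
  have box: "freq_square = cbox (- pi, - pi) (pi, pi)"
    by (simp add: freq_square_def cbox_Pair_eq)
  \<comment> \<open>The mode factors into one exponential per variable, so the double integral
    splits into two integrals over a period.\<close>
  have f_eq: "?f = (\<lambda>\<theta>. cis (of_int (- fst k) * fst \<theta>) * cis (of_int (- snd k) * snd \<theta>))"
    by (auto simp: fourier_mode_def cis_mult)
  have cont: "continuous_on freq_square ?f"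
    unfolding f_eq cis_conv_exp by (intro continuous_intros)
  have "set_integrable lebesgue freq_square ?f"
    using cont unfolding box by (intro absolutely_integrable_continuous)
  then have "(LINT \<theta>:freq_square|lebesgue. 1 * ?f \<theta>) = integral freq_square ?f"
    using set_lebesgue_integral_eq_integral(2) by auto
  also have "\<dots> = integral {- pi..pi} (\<lambda>x. integral {- pi..pi} (\<lambda>y. ?f (x, y)))"
    using cont unfolding box by (subst integral_prod_continuous) auto
  also have "\<dots> = integral {- pi..pi} (\<lambda>x. cis (of_int (- fst k) * x)) *
      integral {- pi..pi} (\<lambda>y. cis (of_int (- snd k) * y))"
    by (simp add: f_eq)
  also have "\<dots> = (if k = 0 then of_real ((2 * pi)\<^sup>2) else 0)"
    unfolding integral_cis_period by (auto simp: prod_eq_iff power2_eq_square)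
  finally show ?thesis by (auto simp: fourier_coeff_def)
qed

text \<open>Only the Fourier coefficient at 0 of the symbol 1 survives, and lexicographic indexing
  is injective, so the Toeplitz factor is the identity, as is the sampling factor. Hence a single
  term represents the symbol 1 exactly.\<close>

lemma glt_sum_one: "glt_sum \<nu> 1 (\<lambda>_ _. 1) (\<lambda>_ _. 1) = 1\<^sub>m (msize \<nu>)"
proof -
  obtain n1 n2 where \<nu>: "\<nu> = (n1, n2)" by force
  have "toeplitz2 \<nu> (\<lambda>_. 1) = 1\<^sub>m (msize \<nu>)"
  proof (rule eq_matI)
    fix i j assume "i < dim_row (1\<^sub>m (msize \<nu>) :: complex mat)" "j < dim_col (1\<^sub>m (msize \<nu>) :: complex mat)"
    moreover have "i = j \<longleftrightarrow> i div n2 = j div n2 \<and> i mod n2 = j mod n2"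
      by (metis mult_div_mod_eq)
    ultimately show "toeplitz2 \<nu> (\<lambda>_. 1) $$ (i, j) = 1\<^sub>m (msize \<nu>) $$ (i, j)"
      by (auto simp: toeplitz2_def fourier_coeff_one \<nu> zero_prod_def)
  qed (auto simp: toeplitz2_def)
  moreover have "diag_sampling2 \<nu> (\<lambda>_. 1) = 1\<^sub>m (msize \<nu>)"
    by (auto simp: diag_sampling2_def mat_diag_def intro!: eq_matI)
  ultimately show ?thesis
    by (auto simp: glt_sum_def intro!: eq_matI)
qed

lemma two_level_GLT_one_if_low_rank:
  fixes s :: "nat \<Rightarrow> nat"
  assumes \<nu>: "filterlim (\<lambda>k. min (fst (\<nu> k)) (snd (\<nu> k))) at_top sequentially"
    and pos: "\<And>k. 0 < msize (\<nu> k)"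
    and X: "\<And>k. X k \<in> carrier_mat (msize (\<nu> k)) (msize (\<nu> k))"
    and rank: "\<And>k. vec_space.rank (msize (\<nu> k)) (X k - 1\<^sub>m (msize (\<nu> k))) \<le> s k"
    and lim: "(\<lambda>k. real (s k) / real (msize (\<nu> k))) \<longlonglongrightarrow> 0"
  shows "two_level_GLT \<nu> X (\<lambda>_. 1)"
proof -
  \<comment> \<open>The approximants do not depend on r: the remainder X - 1 goes entirely into the
    low-rank part and the small-norm part is 0. Since s / d tends to 0 in k, it falls below the
    chosen 1 / (r + 1) for all large k, with a threshold depending on r.\<close>
  have "acs \<nu> (\<lambda>r k. glt_sum (\<nu> k) 1 (\<lambda>_ _. 1) (\<lambda>_ _. 1)) X"
    unfolding acs_def glt_sum_one
  proof (rule exI[of _ "\<lambda>r. 1 / real (Suc r)"], rule exI[of _ "\<lambda>_. 0"], intro conjI allI)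
    fix r
    have "\<forall>\<^sub>F k in sequentially. real (s k) / real (msize (\<nu> k)) < 1 / real (Suc r)"
      using lim by (rule order_tendstoD) simp
    then show "\<forall>\<^sub>F k in sequentially.
        \<exists>R \<in> carrier_mat (msize (\<nu> k)) (msize (\<nu> k)). \<exists>E \<in> carrier_mat (msize (\<nu> k)) (msize (\<nu> k)).
          X k = 1\<^sub>m (msize (\<nu> k)) + R + E \<and>
          real (vec_space.rank (msize (\<nu> k)) R) \<le> 1 / real (Suc r) * real (msize (\<nu> k)) \<and>
          spectral_norm E \<le> 0"
    proof eventually_elim
      case (elim k)
      let ?d = "msize (\<nu> k)"
      have "real (vec_space.rank ?d (X k - 1\<^sub>m ?d)) \<le> real (s k)" using rank[of k] by simp
      also have "\<dots> \<le> 1 / real (Suc r) * real ?d"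
        using elim pos[of k] by (simp add: field_simps)
      finally have "real (vec_space.rank ?d (X k - 1\<^sub>m ?d)) \<le> 1 / real (Suc r) * real ?d" .
      moreover have "X k = 1\<^sub>m ?d + (X k - 1\<^sub>m ?d) + 0\<^sub>m ?d ?d"
        using X[of k] by (intro eq_matI) auto
      ultimately show ?case
        using spectral_norm_zero[OF pos[of k]] X[of k]
        by (intro bexI[of _ "X k - 1\<^sub>m ?d"] bexI[of _ "0\<^sub>m ?d ?d"]) auto
    qed
  qed (use LIMSEQ_inverse_real_of_nat in \<open>auto simp: inverse_eq_divide\<close>)
  moreover have "trig_polynomial (\<lambda>_. 1)"
    unfolding trig_polynomial_def
    by (intro exI[of _ "{0}"] exI[of _ "\<lambda>_. 1"]) (auto simp: fourier_mode_def)
  ultimately show ?thesis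
    unfolding two_level_GLT_def using \<nu> X
    by (intro conjI exI[of _ "\<lambda>_. 1"] exI[of _ "\<lambda>_ _ _. 1"]) (auto simp: converges_in_measure_def case_prod_unfold)
qed

section \<open>The preconditioned matrices\<close>

lemma preconditioned_unit_cols:
  fixes \<xi> \<eta> \<rho> T l :: real and a q :: "real \<Rightarrow> real" and n m :: nat
  assumes inv: "invertible_mat (P_mat \<xi> \<eta> \<rho> T l a n m)"
  defines "X \<equiv> preconditioned \<xi> \<eta> \<rho> T l a q n m"
  shows "X \<in> carrier_mat (n * m + m) (n * m + m)"
    and "\<And>i j. i < n * m + m \<Longrightarrow> j < n * m \<Longrightarrow> X $$ (i, j) = (if i = j then 1 else 0)"
proof -
  let ?P = "P_mat \<xi> \<eta> \<rho> T l a n m" and ?A = "A_mat \<xi> \<eta> \<rho> T l a q n m" and ?d = "n * m + m"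
  have dims: "block11 \<xi> \<eta> \<rho> T a n m \<in> carrier_mat (n * m) (n * m)" "G_mat \<eta> a m \<in> carrier_mat m m"
    by (auto simp: block11_def kronecker_def G_mat_def B_mat_def mat_diag_def)
  have P: "?P \<in> carrier_mat ?d ?d" and A: "?A \<in> carrier_mat ?d ?d"
    unfolding P_mat_def A_mat_def using dims by (auto intro!: four_block_carrier_mat)
  \<comment> \<open>The two matrices differ only in the upper right block, whose columns start at
    index \<open>n * m\<close>.\<close>
  have cols: "col ?A j = col ?P j" if "j < n * m" for j
    using that dims P A by (intro eq_vecI) (auto simp: P_mat_def A_mat_def)
  obtain B where B: "inverts_mat ?P B" "inverts_mat B ?P"
    using inv by (auto simp: invertible_mat_def)
  \<comment> \<open>\<open>mat_inverse\<close> is characterised by the units of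
    \<open>ring_mat\<close>, whereas \<open>invertible_mat\<close> gives a \<open>B\<close> of
    unstated size. The column counts of the two products recover its dimensions.\<close>
  have "?P \<in> Units (ring_mat TYPE(real) ?d b)" for b :: unit
  proof -
    have "dim_col (?P * B) = ?d" "dim_col (B * ?P) = dim_row B"
      using B P by (auto simp: inverts_mat_def)
    then have "B \<in> carrier_mat ?d ?d"
      using P by auto
    then show ?thesis
      using B P by (auto simp: Units_def ring_mat_simps inverts_mat_def)
  qed
  then obtain Q where Q: "mat_inverse ?P = Some Q"
    using mat_inverse(1)[OF P, of "()"] by (cases "mat_inverse ?P") auto
  note inverse = mat_inverse(2)[OF P Q]
  have X: "X = map_mat complex_of_real (Q * ?A)"
    by (simp add: X_def preconditioned_def Q)
  show "X \<in> carrier_mat ?d ?d" using inverse A unfolding X by (metis map_carrier_mat mult_carrier_mat)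
  show "X $$ (i, j) = (if i = j then 1 else 0)" if "i < ?d" "j < n * m" for i j
  proof -
    have "(Q * ?A) $$ (i, j) = scalar_prod (row Q i) (col ?P j)"
      using that inverse A cols by auto
    also have "\<dots> = (Q * ?P) $$ (i, j)" using that inverse P by (subst index_mult_mat) auto
    also have "\<dots> = (if i = j then 1 else 0)" using that inverse by auto
    finally show ?thesis using that inverse A by (auto simp: X)
  qed
qed

theorem theorem5p2:
  fixes \<xi> \<eta> \<rho> T l :: real and a q :: "real \<Rightarrow> real" and n m :: "nat \<Rightarrow> nat"
  assumes "0 < \<xi>" "\<xi> < 1" "0 < \<eta>" "\<eta> < 1" "0 < \<rho>" "0 < T" "0 < l"
    and "AE x in lebesgue_on {0..1}. continuous (at x within {0..1}) a"
    and "\<forall>x\<in>{0..1}. a x \<noteq> 0"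
    and "\<forall>k. 0 < n k \<and> 0 < m k"
    and "filterlim n at_top sequentially" "filterlim m at_top sequentially"
    and "\<forall>k. invertible_mat (P_mat \<xi> \<eta> \<rho> T l a (n k) (m k))"
  shows "two_level_GLT (\<lambda>k. (n k + 1, m k))
           (\<lambda>k. preconditioned \<xi> \<eta> \<rho> T l a q (n k) (m k)) (\<lambda>_. 1)
       \<and> sv_distributed (\<lambda>k. preconditioned \<xi> \<eta> \<rho> T l a q (n k) (m k)) glt_domain (\<lambda>_. 1)
       \<and> ev_distributed (\<lambda>k. preconditioned \<xi> \<eta> \<rho> T l a q (n k) (m k)) glt_domain (\<lambda>_. 1)"
proof -
  define X where "X k = preconditioned \<xi> \<eta> \<rho> T l a q (n k) (m k)" for k
  define d where "d k = n k * m k + m k" for k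
  have pos: "0 < n k" "0 < m k" "0 < d k" for k
    using assms(10) by (auto simp: d_def)
  have X: "X k \<in> carrier_mat (d k) (d k)" for k
    using preconditioned_unit_cols(1) assms(13) by (simp add: X_def d_def)
  have cols: "X k $$ (i, j) = (if i = j then 1 else 0)" if "i < d k" "j < n k * m k" for k i j
    using preconditioned_unit_cols(2) assms(13) that by (simp add: X_def d_def)
  have dim: "dim_row (X k) = d k" "dim_col (X k) = d k" for k
    using X[of k] by auto
  have d_eq: "real (d k) = real (n k + 1) * real (m k)" for k
    by (simp add: d_def algebra_simps)
  \<comment> \<open>The bound \<open>m k\<close> on the rank of X - 1 is the fraction 1 / (n + 1) of
    the size, so the growth of \<open>n\<close> makes it negligible.\<close>
  have ratio: "real (m k) / real (d k) = 1 / real (n k + 1)" for k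
    using pos(2)[of k] by (simp add: d_eq)
  have "filterlim (\<lambda>k. real (n k + 1)) at_top sequentially"
    by (rule filterlim_compose[OF filterlim_real_sequentially filterlim_at_top_mono[OF assms(11)]]) auto
  then have lim: "(\<lambda>k. real (m k) / real (d k)) \<longlonglongrightarrow> 0"
    unfolding ratio by (rule real_tendsto_divide_at_top[OF tendsto_const])
  \<comment> \<open>The multiplicity of 1 is bounded below by n m - m, while the size is n m + m.
    The gap is 2 m.\<close>
  then have lim2: "(\<lambda>k. real (2 * m k) / real (d k)) \<longlonglongrightarrow> 0"
    using tendsto_mult_left[OF lim, of 2] by simp
  have "two_level_GLT (\<lambda>k. (n k + 1, m k)) X (\<lambda>_. 1)"
  proof (rule two_level_GLT_one_if_low_rank[where s = m])
    show "filterlim (\<lambda>k. min (fst (n k + 1, m k)) (snd (n k + 1, m k))) at_top sequentially"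
      unfolding filterlim_at_top
    proof
      fix Z
      have "eventually (\<lambda>k. Z \<le> n k) sequentially" "eventually (\<lambda>k. Z \<le> m k) sequentially"
        using assms(11,12) by (auto simp: filterlim_at_top)
      then show "eventually (\<lambda>k. Z \<le> min (fst (n k + 1, m k)) (snd (n k + 1, m k))) sequentially"
        by eventually_elim auto
    qed
    have d: "msize (n k + 1, m k) = d k" for k by (simp add: d_def)
    show "0 < msize (n k + 1, m k)" for k unfolding d by (rule pos)
    show "X k \<in> carrier_mat (msize (n k + 1, m k)) (msize (n k + 1, m k))" for k
      unfolding d by (rule X)
    show "vec_space.rank (msize (n k + 1, m k)) (X k - 1\<^sub>m (msize (n k + 1, m k))) \<le> m k" for k
      unfolding d using X[of k] cols[of _ k]
      by (intro rank_le_nonzero_cols[where p = "n k * m k"]) (auto simp: d_def)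
    show "(\<lambda>k. real (m k) / real (msize (n k + 1, m k))) \<longlonglongrightarrow> 0"
      unfolding d by (rule lim)
  qed
  moreover have "matrix_seq X"
  proof -
    have "filterlim d at_top sequentially"
      by (rule filterlim_at_top_mono[OF assms(12)]) (auto simp: d_def)
    then show ?thesis by (simp add: matrix_seq_def dim)
  qed
  moreover have "(\<lambda>k. (1 / of_nat (dim_row (X k))) * (\<Sum>s\<in>#singvals (X k). F s)) \<longlonglongrightarrow> F 1"
    if F: "continuous_on UNIV F" "compactly_supported F" for F :: "real \<Rightarrow> complex"
  proof -
    obtain C where C: "\<And>x. cmod (F x) \<le> C" using compactly_supported_bounded[OF F] by blast
    have count: "n k * m k \<le> count (singvals (X k)) 1 + m k" for k
      using X[of k] cols[of _ k] by (intro count_singvals_unit_cols) (auto simp: d_def)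
    have "d k \<le> count (singvals (X k)) 1 + 2 * m k" for k
      using count[of k] by (simp add: d_def)
    then have "(\<lambda>k. (1 / of_nat (d k)) * (\<Sum>s\<in>#singvals (X k). F s)) \<longlonglongrightarrow> F 1"
      by (intro average_tendsto_cluster_value[OF C _ _ _ lim2])
        (auto simp: size_singvals[OF X] pos)
    then show ?thesis by (simp add: dim)
  qed
  moreover have "(\<lambda>k. (1 / of_nat (dim_row (X k))) * (\<Sum>z\<in>#eigvals (X k). F z)) \<longlonglongrightarrow> F 1"
    if F: "continuous_on UNIV F" "compactly_supported F" for F :: "complex \<Rightarrow> complex"
  proof -
    obtain C where C: "\<And>x. cmod (F x) \<le> C" using compactly_supported_bounded[OF F] by blast
    have count: "n k * m k \<le> count (eigvals (X k)) 1 + m k" for k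
      using X[of k] cols[of _ k] by (intro count_eigvals_unit_cols) (auto simp: d_def)
    have "d k \<le> count (eigvals (X k)) 1 + 2 * m k" for k
      using count[of k] by (simp add: d_def)
    then have "(\<lambda>k. (1 / of_nat (d k)) * (\<Sum>z\<in>#eigvals (X k). F z)) \<longlonglongrightarrow> F 1"
      by (intro average_tendsto_cluster_value[OF C _ _ _ lim2])
        (auto simp: size_eigvals[OF X] pos)
    then show ?thesis by (simp add: dim)
  qed
  \<comment> \<open>Both limit integrals have the constant integrand \<open>F 1\<close>, the
    singular value case because \<open>cmod 1 = 1\<close>, so their averages over the domain equal
    \<open>F 1\<close>.\<close>
  ultimately have "two_level_GLT (\<lambda>k. (n k + 1, m k)) X (\<lambda>_. 1)
      \<and> sv_distributed X glt_domain (\<lambda>_. 1) \<and> ev_distributed X glt_domain (\<lambda>_. 1)"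
    unfolding sv_distributed_def ev_distributed_def norm_one average_const_glt_domain
    using distribution_function_glt_domain[of 1] by blast
  then show ?thesis unfolding X_def .
qed

end
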